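(* For any pair of users $u_1,u_2\in\mathcal{V}$, if $z^*(u_1)\ge z^*(u_2)$, then $\delta^*_{u_1}\ge\delta^*_{u_2}$.
   Context: There are $n$ users $\mathcal{V}=\{1,\dots,n\}$. $\mathbf{W}\in\mathbb{R}^{n\times n}$ is entrywise nonnegative with $\mathbf{W}\mathbf{1}=\mathbf{1}$, where $\mathbf{1}$ is the all-ones vector. $\mathbf{A}=\mathrm{Diag}(\alpha_1,\dots,\alpha_n)$ with $0<\alpha_i<1$, and $\mathbf{s}\in\mathbb{R}^n$ is the vector of internal opinions. $\mathbf{B}=[\mathbf{I}-(\mathbf{I}-\mathbf{A})\mathbf{W}]^{-1}$. The equilibrium expressed opinions (without perturbation) are $\mathbf{z}^*=\mathbf{B}\mathbf{A}\mathbf{s}$, with $u$-th entry $z^*(u)$. Define $\mathbf{c}_1=(\mathbf{1}^T\mathbf{B}(\mathbf{I}-\mathbf{A}))^T$ and $\mathbf{c}_2=\mathbf{W}\mathbf{z}^*$, with entries $c_1(v)$, $c_2(v)$. Let $k$ be a fixed positive integer (the maximal number of target users per attacker). The optimal individual influence of user $u$ is $$\delta_u^*=\max_{\mathcal{T}_u\subseteq\mathcal{V},\ |\mathcal{T}_u|\le k}\ \sum_{v\in\mathcal{T}_u}c_1(v)\,\big(z^*(u)-c_2(v)\big),$$ where the empty sum is $0$. *)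

theory Defs
  imports "HOL-Analysis.Analysis"
begin

definition diag_mat :: "real ^ 'n \<Rightarrow> real ^ 'n ^ 'n" where
  "diag_mat a = (\<chi> i j. if i = j then a $ i else 0)"

definition B_mat :: "real ^ 'n ^ 'n \<Rightarrow> real ^ 'n \<Rightarrow> real ^ 'n ^ 'n" where
  "B_mat W \<alpha> = matrix_inv (mat 1 - (mat 1 - diag_mat \<alpha>) ** W)"

definition z_star :: "real ^ 'n ^ 'n \<Rightarrow> real ^ 'n \<Rightarrow> real ^ 'n \<Rightarrow> real ^ 'n" where
  "z_star W \<alpha> s = (B_mat W \<alpha> ** diag_mat \<alpha>) *v s"

definition c1 :: "real ^ 'n ^ 'n \<Rightarrow> real ^ 'n \<Rightarrow> real ^ 'n" where
  "c1 W \<alpha> = 1 v* (B_mat W \<alpha> ** (mat 1 - diag_mat \<alpha>))"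

definition c2 :: "real ^ 'n ^ 'n \<Rightarrow> real ^ 'n \<Rightarrow> real ^ 'n \<Rightarrow> real ^ 'n" where
  "c2 W \<alpha> s = W *v z_star W \<alpha> s"

(* The users are the elements of the finite index type 'n, so a target set is any T :: 'n set;
   the Max ranges over a finite set of values that is nonempty because T = {} is admissible. *)
definition delta_star ::
    "real ^ 'n ^ 'n \<Rightarrow> real ^ 'n \<Rightarrow> real ^ 'n \<Rightarrow> nat \<Rightarrow> 'n \<Rightarrow> real" where
  "delta_star W \<alpha> s k u =
     Max ((\<lambda>T. \<Sum>v\<in>T. c1 W \<alpha> $ v * (z_star W \<alpha> s $ u - c2 W \<alpha> s $ v)) ` {T. card T \<le> k})"

end

theory Submission
  imports Defs
begin

text \<open>
  The matrix \<open>I - (I - A) W\<close> is strictly diagonally dominant with nonpositive off-diagonal entries,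
  so it satisfies a minimum principle, whence its inverse \<open>B\<close> is entrywise nonnegative and
  \<open>c\<^sub>1 \<ge> 0\<close>. Every target set then contributes an amount that is nondecreasing in \<open>z\<^sup>*(u)\<close>.
\<close>

text \<open>At an index \<open>m\<close> minimizing \<open>x\<close>, row \<open>m\<close> of the
  hypothesis gives \<open>x $ m\<close> \<ge> sum of \<open>P $ m $ j * x $ j\<close> \<ge>
  \<open>r * x $ m\<close>, where \<open>r\<close> < 1 is the row sum; hence \<open>x $ m\<close>
  \<ge> 0.\<close>

lemma substochastic_min_principle:
  fixes P :: "real ^ 'n ^ 'n" and x :: "real ^ 'n"
  assumes P: "\<And>i j. 0 \<le> P $ i $ j"
    and rows: "\<And>i. (\<Sum>j\<in>UNIV. P $ i $ j) < 1"
    and x: "\<And>i. 0 \<le> ((mat 1 - P) *v x) $ i"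
  shows "0 \<le> x $ i"
proof -
  obtain m where m: "\<And>j. x $ m \<le> x $ j"
    using arg_min_if_finite[of UNIV "\<lambda>j. x $ j"] by (metis UNIV_I UNIV_not_empty finite not_le)
  have "(\<Sum>j\<in>UNIV. P $ m $ j) * x $ m \<le> (\<Sum>j\<in>UNIV. P $ m $ j * x $ j)"
    unfolding sum_distrib_right using P m by (intro sum_mono mult_left_mono)
  also have "\<dots> \<le> x $ m"
    using x[of m] by (simp add: matrix_vector_mult_diff_rdistrib matrix_vector_mult_def[of P])
  finally have "0 \<le> (1 - (\<Sum>j\<in>UNIV. P $ m $ j)) * x $ m"
    by (simp add: algebra_simps)
  with rows[of m] have "0 \<le> x $ m"
    by (simp add: zero_le_mult_iff)
  with m show ?thesis
    using order_trans by blast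
qed

text \<open>Column \<open>j\<close> of the inverse solves \<open>(mat 1 - P) *v x\<close> = j-th
  unit vector, whose entries are nonnegative, so the minimum principle applies to it.\<close>

lemma substochastic_inv_nonneg:
  fixes P :: "real ^ 'n ^ 'n"
  assumes P: "\<And>i j. 0 \<le> P $ i $ j"
    and rows: "\<And>i. (\<Sum>j\<in>UNIV. P $ i $ j) < 1"
  shows "0 \<le> matrix_inv (mat 1 - P) $ i $ j"
proof -
  let ?M = "mat 1 - P"
  \<comment> \<open>The minimum principle applies to both \<open>x\<close> and \<open>- x\<close>,
    so the kernel is trivial.\<close>
  have "x = 0" if "?M *v x = 0" for x
  proof -
    have "0 \<le> x $ i" "0 \<le> (- x) $ i" for i
      using substochastic_min_principle[OF P rows, of x i]
        substochastic_min_principle[OF P rows, of "- x" i] that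
        linear_neg[OF matrix_vector_mul_linear, of ?M x]
      by simp_all
    then show ?thesis
      by (simp add: vec_eq_iff order_antisym)
  qed
  then have "invertible ?M"
    by (metis invertible_left_inverse matrix_left_invertible_ker)
  \<comment> \<open>\<open>matrix_inv\<close> is a Hilbert choice, so it is a true inverse only once
    invertibility is known.\<close>
  from someI_ex[OF this[unfolded invertible_def]] have inv: "?M ** matrix_inv ?M = mat 1"
    unfolding matrix_inv_def by (rule conjunct1)
  have "?M *v column j (matrix_inv ?M) = column j (?M ** matrix_inv ?M)"
    by (simp add: vec_eq_iff column_def matrix_vector_mult_def matrix_matrix_mult_def)
  then have "?M *v column j (matrix_inv ?M) = column j (mat 1)"
    unfolding inv .
  then have "0 \<le> (?M *v column j (matrix_inv ?M)) $ l" for l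
    by (simp only:) (simp add: column_def mat_def)
  then have "0 \<le> column j (matrix_inv ?M) $ i"
    by (rule substochastic_min_principle[OF P rows])
  then show ?thesis
    by (simp add: column_def)
qed

lemma diag_compl_mult_nth:
  "((mat 1 - diag_mat a) ** W) $ i $ j = (1 - a $ i) * W $ i $ j"
proof -
  have "((mat 1 - diag_mat a) ** W) $ i $ j = (\<Sum>k\<in>UNIV. if k = i then (1 - a $ i) * W $ k $ j else 0)"
    unfolding matrix_matrix_mult_def vec_lambda_beta
    by (rule sum.cong) (auto simp: diag_mat_def mat_def)
  then show ?thesis
    by simp
qed

lemma c1_nonneg:
  assumes W: "\<And>i j. 0 \<le> W $ i $ j" "W *v 1 = 1"
    and \<alpha>: "\<And>i. 0 < \<alpha> $ i \<and> \<alpha> $ i < 1"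
  shows "0 \<le> c1 W \<alpha> $ v"
proof -
  have "(\<Sum>j\<in>UNIV. W $ i $ j) = 1" for i
    using arg_cong[OF W(2), of "\<lambda>x. x $ i"] by (simp add: matrix_vector_mult_def)
  \<comment> \<open>Row \<open>i\<close> of (I - A) W sums to \<open>1 - \<alpha> $ i\<close>, which
    is below 1 because \<open>\<alpha> $ i\<close> > 0.\<close>
  then have B: "0 \<le> B_mat W \<alpha> $ i $ j" for i j
    unfolding B_mat_def using W(1) \<alpha>
    by (intro substochastic_inv_nonneg)
      (auto simp: diag_compl_mult_nth less_imp_le simp flip: sum_distrib_left)
  have "0 \<le> (mat 1 - diag_mat \<alpha>) $ i $ j" for i j
    using \<alpha>[of i] by (auto simp: mat_def diag_mat_def less_imp_le)
  with B show ?thesis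
    by (simp add: c1_def vector_matrix_mult_def matrix_matrix_mult_def sum_nonneg)
qed

theorem proposition2:
  fixes W :: "real ^ 'n ^ 'n" and \<alpha> s :: "real ^ 'n" and k :: nat and u1 u2 :: 'n
  assumes "\<And>i j. 0 \<le> W $ i $ j"
    and "W *v 1 = 1"
    and "\<And>i. 0 < \<alpha> $ i \<and> \<alpha> $ i < 1"
    and "0 < k"
    and "z_star W \<alpha> s $ u1 \<ge> z_star W \<alpha> s $ u2"
  shows "delta_star W \<alpha> s k u1 \<ge> delta_star W \<alpha> s k u2"
proof -
  let ?f = "\<lambda>u T. \<Sum>v\<in>T. c1 W \<alpha> $ v * (z_star W \<alpha> s $ u - c2 W \<alpha> s $ v)"
  let ?T = "{T :: 'n set. card T \<le> k}"
  \<comment> \<open>For a fixed target set the users differ only through z*(u), which enters each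
    term with weight \<open>c1\<close> \<ge> 0.\<close>
  have le: "?f u2 T \<le> ?f u1 T" for T
    using c1_nonneg[OF assms(1-3)] assms(5) by (intro sum_mono mult_left_mono) auto
  have "Max (?f u2 ` ?T) \<le> Max (?f u1 ` ?T)"
  \<comment> \<open>Any set admissible for \<open>u2\<close> is admissible for \<open>u1\<close>, so
    its value is at most the maximum for \<open>u1\<close>.\<close>
  proof (rule Max.boundedI)
    have "{} \<in> ?T"
      by simp
    then show "?f u2 ` ?T \<noteq> {}"
      by blast
  next
    fix y
    assume "y \<in> ?f u2 ` ?T"
    then obtain T where T: "T \<in> ?T" and y: "y = ?f u2 T"
      by (rule imageE)
    from T have "?f u1 T \<le> Max (?f u1 ` ?T)"
      by (intro Max_ge finite_imageI finite imageI)
    with le[of T] show "y \<le> Max (?f u1 ` ?T)"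
      unfolding y by (rule order_trans)
  qed (intro finite_imageI finite)
  then show ?thesis
    unfolding delta_star_def .
qed

end
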